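(* Let $X$ be an implicative-orthomodular lattice and let $x\in X$. The following are equivalent: (a) $x\in\mathcal{C}(X)$; (b) $\mathcal{K}(x)=\{x^*\}$.
   Context: A BE algebra is an algebra $(X,\to,1)$ of type $(2,0)$ such that for all $x,y,z\in X$: $x\to x=1$; $x\to 1=1$; $1\to x=x$; $x\to(y\to z)=y\to(x\to z)$. Write $x\le y$ iff $x\to y=1$. It is bounded if there is $0\in X$ with $0\le x$ for all $x\in X$; then $x^*:=x\to 0$. A bounded BE algebra is involutive if $x^{**}=x$ for all $x$. A BE algebra is implicative if $(x\to y)\to x=x$ for all $x,y$. In an involutive BE algebra put $x\Cap y:=((x^*\to y^* )\to y^* )^*$. An implicative-orthomodular lattice is an implicative involutive BE algebra satisfying $x\Cap(y\to x)=x$ for all $x,y$. An element $x$ commutes with $y$, written $x\mathcal{C}y$, if $x=(x\to y^* )\to(x\to y)^*$. The center of $X$ is $\mathcal{C}(X)=\{x\in X\mid x\mathcal{C}y \text{ for all } y\in X\}$. For $x\in X$, $\mathcal{K}(x)=\{z\in X\mid x\to z^*=x^*\to z=1\}$ is the set of all complements of $x$. *)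

theory Defs
  imports Main
begin

text \<open>
  Algebras are represented with the type \<^typ>\<open>'a\<close> as carrier. The element \<open>0\<close> of a bounded
  BE algebra is a parameter, since \<open>x\<^sup>\<star>\<close> refers to it.
\<close>

locale be_algebra =
  fixes imp :: "'a \<Rightarrow> 'a \<Rightarrow> 'a"  (infixr \<open>\<rightarrow>\<close> 60)
    and one :: 'a  (\<open>\<one>\<close>)
  assumes imp_self: "x \<rightarrow> x = \<one>"
    and imp_one: "x \<rightarrow> \<one> = \<one>"
    and one_imp: "\<one> \<rightarrow> x = x"
    and imp_exchange: "x \<rightarrow> (y \<rightarrow> z) = y \<rightarrow> (x \<rightarrow> z)"
begin

definition le :: "'a \<Rightarrow> 'a \<Rightarrow> bool"  (infix \<open>\<preceq>\<close> 50)
  where "x \<preceq> y \<longleftrightarrow> x \<rightarrow> y = \<one>"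

end

locale bounded_be_algebra = be_algebra imp one
  for imp :: "'a \<Rightarrow> 'a \<Rightarrow> 'a"  (infixr \<open>\<rightarrow>\<close> 60)
    and one :: 'a  (\<open>\<one>\<close>) +
  fixes zero :: 'a  (\<open>\<zero>\<close>)
  assumes zero_le: "\<zero> \<preceq> x"
begin

definition star :: "'a \<Rightarrow> 'a"  (\<open>_\<^sup>\<star>\<close> [1000] 1000)
  where "x\<^sup>\<star> = x \<rightarrow> \<zero>"

definition cap :: "'a \<Rightarrow> 'a \<Rightarrow> 'a"  (infixl \<open>\<Cap>\<close> 70)
  where "x \<Cap> y = ((x\<^sup>\<star> \<rightarrow> y\<^sup>\<star>) \<rightarrow> y\<^sup>\<star>)\<^sup>\<star>"

definition commutes :: "'a \<Rightarrow> 'a \<Rightarrow> bool"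
  where "commutes x y \<longleftrightarrow> x = (x \<rightarrow> y\<^sup>\<star>) \<rightarrow> (x \<rightarrow> y)\<^sup>\<star>"

definition center :: "'a set"
  where "center = {x. \<forall>y. commutes x y}"

definition complements :: "'a \<Rightarrow> 'a set"
  where "complements x = {z. x \<rightarrow> z\<^sup>\<star> = \<one> \<and> x\<^sup>\<star> \<rightarrow> z = \<one>}"

end

locale involutive_be_algebra = bounded_be_algebra +
  assumes star_star: "(x\<^sup>\<star>)\<^sup>\<star> = x"

locale implicative_be_algebra = be_algebra +
  assumes implicative: "(x \<rightarrow> y) \<rightarrow> x = x"

locale implicative_orthomodular_lattice =
  involutive_be_algebra imp one zero + implicative_be_algebra imp one
  for imp :: "'a \<Rightarrow> 'a \<Rightarrow> 'a"  (infixr \<open>\<rightarrow>\<close> 60)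
    and one :: 'a  (\<open>\<one>\<close>)
    and zero :: 'a  (\<open>\<zero>\<close>) +
  assumes cap_imp: "x \<Cap> (y \<rightarrow> x) = x"

end

theory Submission
  imports Defs "HOL-Library.Complemented_Lattices"
begin

text \<open>
  With \<open>x \<squnion> y = x\<^sup>\<star> \<rightarrow> y\<close>, \<open>x \<sqinter> y = (x \<rightarrow> y\<^sup>\<star>)\<^sup>\<star>\<close> and the order \<open>x \<sqinter> y = x\<close>, an
  implicative-orthomodular lattice is an orthomodular lattice; the order \<open>x \<preceq> y\<close>, that is
  \<open>x\<^sup>\<star> \<squnion> y = \<one>\<close>, is in general strictly weaker. If \<open>x\<close> commutes with a complement \<open>z\<close>, then
  orthomodularity gives \<open>z = x\<^sup>\<star>\<close>. Conversely, for any \<open>y\<close> the element \<open>q = y \<sqinter> (x \<sqinter> y)\<^sup>\<star>\<close> is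
  disjoint from \<open>x\<close>, hence below the complement \<open>q \<squnion> (x \<squnion> q)\<^sup>\<star>\<close> of \<open>x\<close>. If \<open>x\<^sup>\<star>\<close> is the only
  complement, then \<open>q \<le> x\<^sup>\<star>\<close>, so \<open>y = (x \<sqinter> y) \<squnion> q\<close> commutes with \<open>x\<close>, and \<open>x\<close> with \<open>y\<close>.
\<close>

context orthomodular_lattice
  opening lattice_syntax
begin

text \<open>De Morgan turns the hypothesis into a meet for \<open>- y\<close>. In
  \<open>x \<sqinter> - y\<close> the factor \<open>- y \<squnion> x\<close> is absorbed by
  \<open>x\<close>, which leaves \<open>- (x \<sqinter> y) \<sqinter> x\<close>; orthomodularity for
  \<open>x \<sqinter> y \<le> x\<close> finishes.\<close>

lemma commutes_sym:
  assumes "y = (y \<sqinter> x) \<squnion> (y \<sqinter> - x)"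
  shows "x = (x \<sqinter> y) \<squnion> (x \<sqinter> - y)"
proof -
  have "- y = (- y \<squnion> - x) \<sqinter> (- y \<squnion> x)"
    using arg_cong[OF assms, of uminus] by simp
  then have "x \<sqinter> - y = x \<sqinter> ((- y \<squnion> - x) \<sqinter> (- y \<squnion> x))"
    by simp
  also have "\<dots> = - (x \<sqinter> y) \<sqinter> x"
    by (metis compl_inf inf_assoc inf_commute inf_sup_absorb sup_commute)
  finally show ?thesis
    using orthomodular[of "x \<sqinter> y" x] by simp
qed

lemma commuting_complement:
  assumes "x = (x \<sqinter> z) \<squnion> (x \<sqinter> - z)" and "x \<sqinter> z = \<bottom>" and "x \<squnion> z = \<top>"
  shows "z = - x"
proof -
  have "x \<le> - z"
    using assms(1,2) by (simp add: inf.absorb_iff1)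
  moreover have "- x \<sqinter> - z = \<bottom>"
    using arg_cong[OF assms(3), of uminus] by simp
  ultimately have "x = - z"
    using orthomodular[of x "- z"] by simp
  then show ?thesis
    by simp
qed

lemma disjoint_le_complement:
  assumes "x \<sqinter> q = \<bottom>"
  obtains z where "q \<le> z" "x \<sqinter> z = \<bottom>" "x \<squnion> z = \<top>"
proof
  let ?t = "x \<squnion> q"
  let ?z = "q \<squnion> - ?t"
  show "q \<le> ?z"
    by simp
  show "x \<squnion> ?z = \<top>"
    using sup_compl_top[of ?t] by (simp add: sup_assoc)
  \<comment> \<open>Since \<open>- ?t \<le> - q\<close>, this is orthomodularity. Its complement
    says that \<open>?z\<close> meets \<open>?t\<close> exactly in \<open>q\<close>, and
    \<open>x\<close> lies below \<open>?t\<close>.\<close>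
  have "- q = - ?t \<squnion> ?t \<sqinter> - q"
    using orthomodular[of "- ?t" "- q"] by simp
  then have "q = ?t \<sqinter> ?z"
    using arg_cong[of "- q" "- ?t \<squnion> ?t \<sqinter> - q" uminus]
    by (metis compl_inf compl_sup ortho_involution sup_commute)
  moreover have "x \<sqinter> ?z = x \<sqinter> (?t \<sqinter> ?z)"
    by (metis inf_assoc inf_sup_absorb)
  ultimately show "x \<sqinter> ?z = \<bottom>"
    using assms by simp
qed

lemma commutes_all_iff_unique_complement:
  "(\<forall>y. x = (x \<sqinter> y) \<squnion> (x \<sqinter> - y)) \<longleftrightarrow> {z. x \<sqinter> z = \<bottom> \<and> x \<squnion> z = \<top>} = {- x}"
proof
  assume "\<forall>y. x = (x \<sqinter> y) \<squnion> (x \<sqinter> - y)"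
  then show "{z. x \<sqinter> z = \<bottom> \<and> x \<squnion> z = \<top>} = {- x}"
    using commuting_complement by fastforce
next
  assume unique: "{z. x \<sqinter> z = \<bottom> \<and> x \<squnion> z = \<top>} = {- x}"
  show "\<forall>y. x = (x \<sqinter> y) \<squnion> (x \<sqinter> - y)"
  proof
    fix y
    let ?q = "- (x \<sqinter> y) \<sqinter> y"
    have "x \<sqinter> ?q = (x \<sqinter> y) \<sqinter> - (x \<sqinter> y)"
      by (simp only: inf_aci)
    then have "x \<sqinter> ?q = \<bottom>"
      by (simp only: inf_compl_bot)
    then obtain z where "?q \<le> z" "x \<sqinter> z = \<bottom>" "x \<squnion> z = \<top>"
      by (rule disjoint_le_complement)
    moreover from this have "z = - x"
      using unique by blast
    ultimately have "?q \<le> - x"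
      by simp
    moreover have "y = (x \<sqinter> y) \<squnion> ?q"
      using orthomodular[of "x \<sqinter> y" y] by simp
    \<comment> \<open>Together with \<open>?q \<le> - x\<close> this gives
      \<open>?q = y \<sqinter> - x\<close>, so the splitting of \<open>y\<close> along
      \<open>x \<sqinter> y\<close> becomes commutation of \<open>y\<close> with
      \<open>x\<close>.\<close>
    moreover have "y \<sqinter> - x \<le> ?q"
      by (simp add: le_supI1)
    ultimately have "y = (y \<sqinter> x) \<squnion> (y \<sqinter> - x)"
      by (metis order.antisym inf.bounded_iff inf_commute inf_le2)
    then show "x = (x \<sqinter> y) \<squnion> (x \<sqinter> - y)"
      by (rule commutes_sym)
  qed
qed

end

context implicative_orthomodular_lattice
begin

lemma zero_star: "\<zero>\<^sup>\<star> = \<one>"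
  by (simp add: star_def imp_self)

lemma one_star: "\<one>\<^sup>\<star> = \<zero>"
  by (simp add: star_def one_imp)

lemma imp_star_swap: "x \<rightarrow> y\<^sup>\<star> = y \<rightarrow> x\<^sup>\<star>"
  by (simp add: star_def imp_exchange)

lemma contrapositive: "x\<^sup>\<star> \<rightarrow> y\<^sup>\<star> = y \<rightarrow> x"
  using imp_star_swap[of "x\<^sup>\<star>" y] by (simp add: star_star)

definition meet :: "'a \<Rightarrow> 'a \<Rightarrow> 'a"
  where "meet x y = (x \<rightarrow> y\<^sup>\<star>)\<^sup>\<star>"

definition join :: "'a \<Rightarrow> 'a \<Rightarrow> 'a"
  where "join x y = x\<^sup>\<star> \<rightarrow> y"

lemma star_meet: "(meet x y)\<^sup>\<star> = join (x\<^sup>\<star>) (y\<^sup>\<star>)"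
  by (simp add: meet_def join_def star_star)

lemma star_join: "(join x y)\<^sup>\<star> = meet (x\<^sup>\<star>) (y\<^sup>\<star>)"
  by (simp add: meet_def join_def star_star)

lemma join_commute: "join x y = join y x"
  using contrapositive[of x "y\<^sup>\<star>"] by (simp add: join_def star_star)

lemma join_assoc: "join (join x y) z = join x (join y z)"
  using imp_exchange[of "z\<^sup>\<star>" "x\<^sup>\<star>" y] join_commute
  by (simp add: join_def)

lemma meet_commute: "meet x y = meet y x"
  by (simp add: meet_def imp_star_swap)

lemma meet_assoc: "meet (meet x y) z = meet x (meet y z)"
  using join_assoc[of "x\<^sup>\<star>" "y\<^sup>\<star>" "z\<^sup>\<star>"] star_meet star_star by metis

text \<open>Absorption is the implicative law at \<open>y\<^sup>\<star>\<close>.\<close>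

lemma join_meet_absorb: "join x (meet x y) = x"
proof -
  have "join (meet x y) x = x"
    using implicative[of x "y\<^sup>\<star>"] by (simp add: join_def meet_def star_star)
  then show ?thesis
    by (simp add: join_commute)
qed

lemma meet_join_absorb: "meet x (join x y) = x"
  using join_meet_absorb[of "x\<^sup>\<star>" "y\<^sup>\<star>"] star_join star_meet star_star by metis

lemma meet_eq_iff_join_eq: "meet x y = x \<longleftrightarrow> join x y = y"
  by (metis join_meet_absorb meet_join_absorb join_commute meet_commute)

text \<open>The axiom \<open>cap_imp\<close> at \<open>y\<^sup>\<star>\<close>, rewritten with
  \<open>meet\<close> and \<open>join\<close>: a dual orthomodular law for \<open>x\<close> below
  \<open>join x y\<close>.\<close>

lemma meet_join_star: "meet (join x ((join x y)\<^sup>\<star>)) (join x y) = x"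
proof -
  have "join x y = y\<^sup>\<star> \<rightarrow> x"
    using join_commute by (simp add: join_def)
  moreover have "x \<Cap> z = meet (join x (z\<^sup>\<star>)) z" for z
    by (simp add: cap_def meet_def join_def)
  ultimately show ?thesis
    using cap_imp[of x "y\<^sup>\<star>"] by simp
qed

text \<open>Star reverses the order, so the dual law applies to \<open>y\<^sup>\<star>\<close> below
  \<open>x\<^sup>\<star>\<close>; taking stars yields the form that the class requires.\<close>

lemma join_meet_star: "join x (meet (x\<^sup>\<star>) y) = y" if "meet x y = x"
proof -
  have "join (y\<^sup>\<star>) (x\<^sup>\<star>) = x\<^sup>\<star>"
    using that by (metis star_meet join_commute)
  then have "meet (join (y\<^sup>\<star>) x) (x\<^sup>\<star>) = y\<^sup>\<star>"
    using meet_join_star[of "y\<^sup>\<star>" "x\<^sup>\<star>"] by (simp add: star_star)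
  then have "join (meet y (x\<^sup>\<star>)) x = y"
    by (metis star_join star_meet star_star)
  then show ?thesis
    by (simp add: join_commute meet_commute)
qed

lemma orthomodular_lattice:
  "class.orthomodular_lattice (\<lambda>x y. meet x (y\<^sup>\<star>)) star meet (\<lambda>x y. meet x y = x)
    (\<lambda>x y. meet x y = x \<and> x \<noteq> y) join \<zero> \<one>"
proof unfold_locales
  fix x y z
  show "(meet x y = x \<and> x \<noteq> y) = (meet x y = x \<and> meet y x \<noteq> y)"
    by (metis meet_commute)
  have join_idem: "join x x = x" for x
    by (metis join_meet_absorb meet_join_absorb)
  then show "meet x x = x"
    by (simp add: meet_eq_iff_join_eq)
  show "meet x z = x" if "meet x y = x" "meet y z = y"
    using that by (metis meet_assoc)
  show "x = y" if "meet x y = x" "meet y x = y"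
    using that by (metis meet_commute)
  show "meet (meet x y) x = meet x y" "meet (meet x y) y = meet x y"
    by (metis \<open>meet x x = x\<close> join_idem meet_eq_iff_join_eq meet_assoc meet_commute)+
  show "meet x (meet y z) = x" if "meet x y = x" "meet x z = x"
    using that by (metis meet_assoc)
  show "meet x (join x y) = x" "meet y (join x y) = y"
    by (metis meet_join_absorb join_commute)+
  show "meet (join y z) x = join y z" if "meet y x = y" "meet z x = z"
    using that by (simp add: meet_eq_iff_join_eq join_assoc)
  show "meet \<zero> x = \<zero>"
    by (simp add: meet_eq_iff_join_eq join_def zero_star one_imp)
  show "meet x \<one> = x"
    by (simp add: meet_eq_iff_join_eq join_def imp_one)
  show "meet x (x\<^sup>\<star>) = \<zero>"
    by (simp add: meet_def star_star imp_self one_star)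
  show "join x (x\<^sup>\<star>) = \<one>"
    by (simp add: join_def imp_self)
  show "meet (y\<^sup>\<star>) (x\<^sup>\<star>) = y\<^sup>\<star>" if "meet x y = x"
    using that by (metis meet_eq_iff_join_eq join_commute star_join)
  show "join x (meet (x\<^sup>\<star>) y) = y" if "meet x y = x"
    using that by (rule join_meet_star)
qed (simp_all add: star_star)

lemma commutes_iff: "commutes x y \<longleftrightarrow> x = join (meet x y) (meet x (y\<^sup>\<star>))"
  by (simp add: commutes_def join_def meet_def star_star)

text \<open>Star is an involution exchanging \<open>\<zero>\<close> and \<open>\<one>\<close>, so
  the first condition is disjointness; the second is a join by definition.\<close>

lemma complements_eq: "complements x = {z. meet x z = \<zero> \<and> join x z = \<one>}"
proof -
  have "meet x z = \<zero> \<longleftrightarrow> x \<rightarrow> z\<^sup>\<star> = \<one>" for z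
    unfolding meet_def by (metis star_star one_star zero_star)
  then show ?thesis
    by (simp add: complements_def join_def)
qed

lemma center_iff_complements_eq: "x \<in> center \<longleftrightarrow> complements x = {x\<^sup>\<star>}"
  unfolding center_def mem_Collect_eq commutes_iff complements_eq
  by (rule orthomodular_lattice.commutes_all_iff_unique_complement[OF orthomodular_lattice])

end

theorem corollary5p7:
  fixes imp :: "'a \<Rightarrow> 'a \<Rightarrow> 'a" and one zero :: 'a and x :: 'a
  assumes "implicative_orthomodular_lattice imp one zero"
  shows "x \<in> bounded_be_algebra.center imp zero \<longleftrightarrow>
    bounded_be_algebra.complements imp one zero x = {bounded_be_algebra.star imp zero x}"
  using assms by (rule implicative_orthomodular_lattice.center_iff_complements_eq)

end
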